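(* Let $\xi,\eta\in c_0^*$ with $\xi\prec\eta$. Then there is some $\zeta\in c_0^*$ for which $\xi\preccurlyeq\zeta$ and $\zeta\le\eta$ (termwise).
   Context: $\mathbb N=\{1,2,3,\dots\}$. $c_0^*$ denotes the cone of nonincreasing sequences $\xi=\langle\xi_1,\xi_2,\dots\rangle$ of nonnegative real numbers converging to $0$ (it does not denote a dual space). For $\xi,\eta\in c_0^*$: $\xi\le\eta$ means $\xi_n\le\eta_n$ for all $n$; $\xi\prec\eta$ ($\eta$ majorizes $\xi$) means $\sum_{j=1}^n\xi_j\le\sum_{j=1}^n\eta_j$ for every $n\in\mathbb N$; $\xi\preccurlyeq\eta$ ($\eta$ strongly majorizes $\xi$) means $\xi\prec\eta$ and $\liminf_{n\to\infty}\sum_{j=1}^n(\eta_j-\xi_j)=0$. *)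

theory Defs
  imports "HOL-Analysis.Analysis"
begin

text \<open>
  A sequence \<open>\<xi>\<^sub>1, \<xi>\<^sub>2, \<dots>\<close> indexed from 1 is represented by \<open>\<xi> :: nat \<Rightarrow> real\<close>, with
  \<open>\<xi> k\<close> standing for the entry of index \<open>k + 1\<close>. Hence the sum of the first \<open>n\<close> entries
  is \<open>\<Sum>j<n. \<xi> j\<close>. Despite its name, \<open>c0_star\<close> is a cone of sequences, not a dual space.
\<close>

definition c0_star :: "(nat \<Rightarrow> real) set" where
  "c0_star = {\<xi>. decseq \<xi> \<and> (\<forall>n. 0 \<le> \<xi> n) \<and> \<xi> \<longlonglongrightarrow> 0}"

text \<open>In both relations below, the second sequence is the majorizing one.\<close>

definition majorized :: "(nat \<Rightarrow> real) \<Rightarrow> (nat \<Rightarrow> real) \<Rightarrow> bool"  (infix "\<prec>" 50) where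
  "\<xi> \<prec> \<eta> \<longleftrightarrow> (\<forall>n. (\<Sum>j<n. \<xi> j) \<le> (\<Sum>j<n. \<eta> j))"

text \<open>
  The limit inferior is taken in the extended reals, since the sums need not be bounded.
\<close>

definition strongly_majorized :: "(nat \<Rightarrow> real) \<Rightarrow> (nat \<Rightarrow> real) \<Rightarrow> bool"  (infix "\<preceq>" 50) where
  "\<xi> \<preceq> \<eta> \<longleftrightarrow> \<xi> \<prec> \<eta> \<and> liminf (\<lambda>n. ereal (\<Sum>j<n. \<eta> j - \<xi> j)) = 0"

end

theory Submission
  imports Defs
begin

text \<open>
  By Zorn's lemma there is a pointwise minimal \<open>\<zeta>\<close> among the sequences of \<open>c0_star\<close> with
  \<open>\<xi> \<prec> \<zeta> \<le> \<eta>\<close>. If the gaps between the partial sums of \<open>\<zeta>\<close> and \<open>\<xi>\<close> were eventually bounded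
  below by some \<open>e > 0\<close>, then \<open>\<zeta>\<close> could be lowered at a suitable strict descent by a positive
  amount not exceeding \<open>e\<close>, contradicting minimality.
\<close>

text \<open>One member of \<open>C\<close> gets below the sum of the first \<open>n\<close> infima
  plus \<open>e/2\<close>, another below the next infimum plus \<open>e/2\<close>. Comparability
  makes the smaller of the two do both. This is what lets majorization survive the passage to the
  infimum of a chain.\<close>

lemma chain_INF_sum_approx:
  fixes C :: "(nat \<Rightarrow> real) set"
  assumes "C \<noteq> {}" and chain: "\<And>a b. a \<in> C \<Longrightarrow> b \<in> C \<Longrightarrow> a \<le> b \<or> b \<le> a"
    and "0 < e"
  shows "\<exists>c\<in>C. (\<Sum>j<n. c j) < (\<Sum>j<n. INF c\<in>C. c j) + e"
  using \<open>0 < e\<close>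
proof (induction n arbitrary: e)
  case 0
  then show ?case using assms(1) by auto
next
  case (Suc n)
  then obtain c where c: "c \<in> C" "(\<Sum>j<n. c j) < (\<Sum>j<n. INF c\<in>C. c j) + e/2"
    using half_gt_zero by blast
  have "\<exists>y\<in>(\<lambda>c. c n) ` C. y < (INF c\<in>C. c n) + e/2"
    using assms(1) Suc.prems by (intro cInf_lessD) auto
  then obtain d where d: "d \<in> C" "d n < (INF c\<in>C. c n) + e/2"
    by blast
  show ?case
  proof (cases "c \<le> d")
    case True
    then have "c n \<le> d n" by (rule le_funD)
    with c d show ?thesis by (intro bexI[of _ c]) auto
  next
    case False
    then have "d \<le> c" using chain c(1) d(1) by blast
    then have "(\<Sum>j<n. d j) \<le> (\<Sum>j<n. c j)" by (intro sum_mono) (rule le_funD)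
    with c d show ?thesis by (intro bexI[of _ d]) auto
  qed
qed

lemma c0_star_le:
  assumes "decseq a" and "\<And>n. 0 \<le> a n" and "a \<le> b" and "b \<in> c0_star"
  shows "a \<in> c0_star"
proof -
  have "a \<longlonglongrightarrow> 0"
    by (rule tendsto_sandwich[of "\<lambda>_. 0" a sequentially b])
       (use assms in \<open>auto simp: c0_star_def le_fun_def\<close>)
  with assms show ?thesis by (auto simp: c0_star_def)
qed

text \<open>The pointwise infimum serves as bound. Monotonicity and nonnegativity pass to it entry
  by entry, and convergence to 0 follows from lying below a member of \<open>C\<close>.
  Comparability enters in \<open>\<xi> \<prec> u\<close>, where whole partial sums have to be
  approximated by a single member.\<close>

lemma chain_lower_bound:
  fixes \<xi> \<eta> :: "nat \<Rightarrow> real"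
  defines "A \<equiv> {\<zeta> \<in> c0_star. \<xi> \<prec> \<zeta> \<and> \<zeta> \<le> \<eta>}"
  assumes "C \<subseteq> A" and "C \<noteq> {}"
    and chain: "\<And>a b. a \<in> C \<Longrightarrow> b \<in> C \<Longrightarrow> a \<le> b \<or> b \<le> a"
  shows "\<exists>u\<in>A. \<forall>a\<in>C. u \<le> a"
proof -
  define u where "u = (\<lambda>n. INF c\<in>C. c n)"
  have bdd: "bdd_below ((\<lambda>c. c n) ` C)" for n
    using assms(2) by (intro bdd_belowI[of _ 0]) (auto simp: A_def c0_star_def)
  have le: "u \<le> c" if "c \<in> C" for c
    unfolding u_def le_fun_def using cINF_lower[OF bdd that] by blast
  obtain c where c: "c \<in> C" using assms(3) by blast
  have "u \<in> c0_star"
  proof (rule c0_star_le)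
    show "u \<le> c" using c by (rule le)
    show "c \<in> c0_star" using c assms(2) by (auto simp: A_def)
    show "0 \<le> u n" for n
      unfolding u_def using assms(2,3)
      by (intro cINF_greatest) (auto simp: A_def c0_star_def)
    show "decseq u"
      unfolding u_def decseq_def
    proof (intro allI impI cINF_mono assms(3) bdd)
      fix m n :: nat and a
      assume "m \<le> n" and "a \<in> C"
      then show "\<exists>b\<in>C. b n \<le> a m"
        using assms(2) by (intro bexI[of _ a]) (auto simp: A_def c0_star_def decseq_def)
    qed
  qed
  moreover have "\<xi> \<prec> u"
    unfolding majorized_def
  proof (rule allI, rule field_le_epsilon)
    fix n and e :: real
    assume "0 < e"
    then obtain d where "d \<in> C" and "(\<Sum>j<n. d j) < (\<Sum>j<n. u j) + e"
      unfolding u_def using chain_INF_sum_approx[OF assms(3) chain] by blast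
    moreover have "(\<Sum>j<n. \<xi> j) \<le> (\<Sum>j<n. d j)"
      using \<open>d \<in> C\<close> assms(2) by (auto simp: A_def majorized_def)
    ultimately show "(\<Sum>j<n. \<xi> j) \<le> (\<Sum>j<n. u j) + e" by linarith
  qed
  moreover have "u \<le> \<eta>"
    using le[OF c] c assms(2) by (auto simp: A_def)
  ultimately show ?thesis using le by (auto simp: A_def)
qed

lemma minimal_majorant_exists:
  fixes \<xi> \<eta> :: "nat \<Rightarrow> real"
  defines "A \<equiv> {\<zeta> \<in> c0_star. \<xi> \<prec> \<zeta> \<and> \<zeta> \<le> \<eta>}"
  assumes "\<eta> \<in> c0_star" and "\<xi> \<prec> \<eta>"
  shows "\<exists>m\<in>A. \<forall>a\<in>A. a \<le> m \<longrightarrow> a = m"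
proof (rule predicate_Zorn)
  \<comment> \<open>The order is reversed, so that the maximal element from Zorn's lemma is
    pointwise minimal.\<close>
  show "partial_order_on A (relation_of (\<lambda>x y. y \<le> x) A)"
    by (rule partial_order_on_relation_ofI) auto
next
  fix C
  assume C: "C \<in> Chains (relation_of (\<lambda>x y. y \<le> x) A)"
  show "\<exists>u\<in>A. \<forall>a\<in>C. u \<le> a"
  proof (cases "C = {}")
    case True
    \<comment> \<open>The empty chain is bounded by \<open>\<eta>\<close>, which lies in
      \<open>A\<close>.\<close>
    then show ?thesis using assms by auto
  next
    case False
    then show ?thesis
      using C unfolding A_def
      by (intro chain_lower_bound) (auto simp: Chains_def relation_of_def)
  qed
qed

text \<open>Lowering entry \<open>p\<close> affects exactly the partial sums of more than
  \<open>p\<close> entries, so the gap is demanded for these. If \<open>\<zeta> N\<close> is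
  positive, convergence to 0 forces a descent at or after \<open>N\<close>. Otherwise the last
  positive entry is followed by a descent, possibly before \<open>N\<close>.\<close>

lemma strict_descent_exists:
  fixes \<xi> \<zeta> :: "nat \<Rightarrow> real"
  assumes \<zeta>: "\<zeta> \<in> c0_star" and \<xi>: "\<And>n. 0 \<le> \<xi> n" and "0 < e"
    and gap: "\<And>k. N \<le> k \<Longrightarrow> e \<le> (\<Sum>j<k. \<zeta> j - \<xi> j)"
  shows "\<exists>p. \<zeta> (Suc p) < \<zeta> p \<and> (\<forall>k>p. e \<le> (\<Sum>j<k. \<zeta> j - \<xi> j))"
proof -
  have dec: "decseq \<zeta>" and pos: "\<And>n. 0 \<le> \<zeta> n" and lim: "\<zeta> \<longlonglongrightarrow> 0"
    using \<zeta> by (auto simp: c0_star_def)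
  show ?thesis
  proof (cases "\<zeta> N = 0")
    case False
    have "\<exists>p\<ge>N. \<zeta> (Suc p) < \<zeta> p"
    proof (rule ccontr)
      assume "\<not> ?thesis"
      then have asc: "\<zeta> p \<le> \<zeta> (Suc p)" if "N \<le> p" for p
        using that by (auto simp: not_less)
      have "\<zeta> N \<le> \<zeta> k" if "N \<le> k" for k
        using that
      proof (induction rule: dec_induct)
        case (step k)
        then show ?case using asc[of k] by simp
      qed simp
      then have "\<zeta> N \<le> 0"
        using lim by (intro LIMSEQ_le_const) auto
      with False pos[of N] show False by simp
    qed
    then show ?thesis using gap by (meson less_imp_le order_trans)
  next
    case True
    \<comment> \<open>Beyond the first zero of \<open>\<zeta>\<close> the gaps are nonincreasing, so all of them are at least \<open>e\<close>.\<close>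
    define m where "m = (LEAST n. \<zeta> n = 0)"
    have "\<zeta> m = 0" unfolding m_def using True by (rule LeastI)
    then have zero: "\<zeta> k = 0" if "m \<le> k" for k
      using decseqD[OF dec that] pos[of k] by simp
    have gap_m: "e \<le> (\<Sum>j<k. \<zeta> j - \<xi> j)" if "m \<le> k" for k
    proof -
      \<comment> \<open>Taking \<open>max k N\<close> treats both orders of \<open>k\<close> and
        \<open>N\<close> at once; the entries from \<open>k\<close> on contribute only
        \<open>- \<xi> j\<close>.\<close>
      have "e \<le> (\<Sum>j<max k N. \<zeta> j - \<xi> j)" by (rule gap) simp
      also have "\<dots> \<le> (\<Sum>j<k. \<zeta> j - \<xi> j)"
        using that zero \<xi>
        by (subst sum.subset_diff[of "{..<k}"]) (auto intro!: sum_nonpos)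
      finally show ?thesis .
    qed
    \<comment> \<open>The empty sum has gap 0, which is less than \<open>e\<close>.\<close>
    have "m \<noteq> 0" using gap_m[of 0] \<open>0 < e\<close> by auto
    then obtain p where p: "m = Suc p" by (cases m) auto
    then have "\<zeta> p \<noteq> 0" using not_less_Least[of p "\<lambda>n. \<zeta> n = 0"] by (simp add: m_def)
    then have "\<zeta> (Suc p) < \<zeta> p" using pos[of p] \<open>\<zeta> m = 0\<close> p by simp
    then show ?thesis using gap_m p by auto
  qed
qed

lemma lower_at_descent:
  fixes \<xi> \<zeta> :: "nat \<Rightarrow> real"
  assumes \<zeta>: "\<zeta> \<in> c0_star" and maj: "\<xi> \<prec> \<zeta>" and "\<zeta> (Suc p) < \<zeta> p" and "0 < e"
    and gap: "\<And>k. p < k \<Longrightarrow> e \<le> (\<Sum>j<k. \<zeta> j - \<xi> j)"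
  shows "\<exists>\<zeta>' \<in> c0_star. \<xi> \<prec> \<zeta>' \<and> \<zeta>' < \<zeta>"
proof -
  \<comment> \<open>The bound \<open>e\<close> preserves majorization beyond \<open>p\<close>; the
    bound by the drop after \<open>p\<close> keeps the lowered sequence nonincreasing and
    nonnegative.\<close>
  define t where "t = min e (\<zeta> p - \<zeta> (Suc p))"
  have t: "0 < t" "t \<le> e" "\<zeta> (Suc p) \<le> \<zeta> p - t"
    using assms(3,4) by (auto simp: t_def)
  define \<zeta>' where "\<zeta>' = \<zeta>(p := \<zeta> p - t)"
  have dec: "decseq \<zeta>" and pos: "\<And>n. 0 \<le> \<zeta> n"
    using \<zeta> by (auto simp: c0_star_def)
  have "\<zeta>' \<le> \<zeta>" using t by (auto simp: \<zeta>'_def le_fun_def)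
  moreover have "\<not> \<zeta> \<le> \<zeta>'" using t by (auto simp: \<zeta>'_def le_fun_def intro!: exI[of _ p])
  ultimately have less: "\<zeta>' < \<zeta>" by (simp add: less_le_not_le)
  have "\<zeta>' \<in> c0_star"
  proof (rule c0_star_le)
    show "decseq \<zeta>'"
    proof (rule decseq_SucI)
      show "\<zeta>' (Suc n) \<le> \<zeta>' n" for n
        using decseq_SucD[OF dec, of n] t by (auto simp: \<zeta>'_def)
    qed
    show "0 \<le> \<zeta>' n" for n
      using pos[of n] pos[of "Suc p"] t by (auto simp: \<zeta>'_def)
  qed (fact \<zeta> \<open>\<zeta>' \<le> \<zeta>\<close>)+
  moreover have "\<xi> \<prec> \<zeta>'"
    unfolding majorized_def
  proof
    fix n
    have "\<zeta>' = (\<lambda>j. \<zeta> j - (if j = p then t else 0))" by (auto simp: \<zeta>'_def)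
    then have sum: "(\<Sum>j<n. \<zeta>' j) = (\<Sum>j<n. \<zeta> j) - (if p < n then t else 0)"
      by (simp add: sum_subtractf)
    show "(\<Sum>j<n. \<xi> j) \<le> (\<Sum>j<n. \<zeta>' j)"
      using maj gap[of n] t by (auto simp: sum sum_subtractf majorized_def)
  qed
  ultimately show ?thesis using less by blast
qed

theorem theorem3p6:
  fixes \<xi> \<eta> :: "nat \<Rightarrow> real"
  assumes "\<xi> \<in> c0_star" and "\<eta> \<in> c0_star" and "\<xi> \<prec> \<eta>"
  shows "\<exists>\<zeta> \<in> c0_star. \<xi> \<preceq> \<zeta> \<and> (\<forall>n. \<zeta> n \<le> \<eta> n)"
proof -
  obtain \<zeta> where \<zeta>: "\<zeta> \<in> c0_star" "\<xi> \<prec> \<zeta>" "\<zeta> \<le> \<eta>"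
    and minimal: "\<And>a. a \<in> c0_star \<Longrightarrow> \<xi> \<prec> a \<Longrightarrow> a \<le> \<eta> \<Longrightarrow> a \<le> \<zeta> \<Longrightarrow> a = \<zeta>"
    using minimal_majorant_exists[OF assms(2,3)] by blast
  let ?D = "\<lambda>n. ereal (\<Sum>j<n. \<zeta> j - \<xi> j)"
  have "0 \<le> liminf ?D"
    using \<zeta>(2) by (intro Liminf_bounded) (auto simp: majorized_def sum_subtractf)
  moreover have "\<not> 0 < liminf ?D"
  proof
    assume "0 < liminf ?D"
    \<comment> \<open>The limit inferior may be infinite, so a real number strictly between 0 and it
      is chosen.\<close>
    then obtain e where e: "0 < ereal e" "ereal e < liminf ?D"
      using ereal_dense2 by blast
    from less_LiminfD[OF e(2)] obtain N where N: "\<And>k. N \<le> k \<Longrightarrow> e \<le> (\<Sum>j<k. \<zeta> j - \<xi> j)"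
      unfolding eventually_sequentially by (auto intro: less_imp_le)
    have "0 < e" and "\<And>n. 0 \<le> \<xi> n" using e(1) assms(1) by (auto simp: c0_star_def)
    with strict_descent_exists[OF \<zeta>(1) _ _ N] obtain p
      where "\<zeta> (Suc p) < \<zeta> p" "\<And>k. p < k \<Longrightarrow> e \<le> (\<Sum>j<k. \<zeta> j - \<xi> j)" by blast
    with lower_at_descent[OF \<zeta>(1,2) _ \<open>0 < e\<close>] obtain a
      where a: "a \<in> c0_star" "\<xi> \<prec> a" "a < \<zeta>" by blast
    then have "a = \<zeta>" using minimal \<zeta>(3) by (meson less_imp_le order_trans)
    with a(3) show False by simp
  qed
  ultimately have "\<xi> \<preceq> \<zeta>"
    using \<zeta>(2) by (auto simp: strongly_majorized_def)
  with \<zeta> show ?thesis by (auto simp: le_fun_def)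
qed

end
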